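(* The set-based models of the geometric theory $\mathbb{F}$ of finite chains are exactly the (simple) MV-algebras that can be embedded in the algebra $\mathbb{Q}\cap[0,1]$.
   Context: An MV-algebra is a structure $(A,\oplus,\neg,0)$ such that $(A,\oplus,0)$ is a commutative monoid, $\neg\neg x=x$, $x\oplus\neg 0=\neg 0$ and $\neg(\neg x\oplus y)\oplus y=\neg(\neg y\oplus x)\oplus x$. For a positive integer $n$, the finite chain $S_n=\Gamma(\mathbb{Z},n)$ is the MV-algebra on $\{0,1,\dots,n\}$ with $x\oplus y=\min(x+y,n)$ and $\neg x=n-x$. $\mathbb{Q}\cap[0,1]$ is the MV-algebra of rationals in $[0,1]$ with $x\oplus y=\min(x+y,1)$, $\neg x=1-x$. An MV-algebra is simple if it has exactly two ideals (downsets containing $0$ and closed under $\oplus$, for the order $x\le y$ iff $\neg x\oplus y=\neg 0$). A geometric sequent is $(\phi\vdash_{\vec x}\psi)$ with $\phi,\psi$ built from atomic formulae using finitary conjunctions, existential quantifications and arbitrary disjunctions. $\mathbb{F}$ is the geometric theory consisting of all geometric sequents over the signature of MV-algebras which are satisfied in every finite chain $S_n$ ($n\ge 1$). *)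

theory Defs
  imports Complex_Main
begin

section \<open>Structures for the signature of MV-algebras\<close>

record 'a mv_struct =
  carr :: "'a set"
  oplus :: "'a \<Rightarrow> 'a \<Rightarrow> 'a"
  neg :: "'a \<Rightarrow> 'a"
  zero :: "'a"

locale mv_structure =
  fixes M :: "'a mv_struct"
  assumes oplus_closed: "x \<in> carr M \<Longrightarrow> y \<in> carr M \<Longrightarrow> oplus M x y \<in> carr M"
    and neg_closed: "x \<in> carr M \<Longrightarrow> neg M x \<in> carr M"
    and zero_closed: "zero M \<in> carr M"

locale mv_algebra = mv_structure +
  assumes oplus_assoc: "\<lbrakk>x \<in> carr M; y \<in> carr M; z \<in> carr M\<rbrakk>
      \<Longrightarrow> oplus M (oplus M x y) z = oplus M x (oplus M y z)"
    and oplus_comm: "\<lbrakk>x \<in> carr M; y \<in> carr M\<rbrakk> \<Longrightarrow> oplus M x y = oplus M y x"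
    and oplus_zero: "x \<in> carr M \<Longrightarrow> oplus M x (zero M) = x"
    and neg_neg: "x \<in> carr M \<Longrightarrow> neg M (neg M x) = x"
    and oplus_neg_zero: "x \<in> carr M \<Longrightarrow> oplus M x (neg M (zero M)) = neg M (zero M)"
    and lukasiewicz: "\<lbrakk>x \<in> carr M; y \<in> carr M\<rbrakk>
      \<Longrightarrow> oplus M (neg M (oplus M (neg M x) y)) y = oplus M (neg M (oplus M (neg M y) x)) x"

definition mv_le :: "'a mv_struct \<Rightarrow> 'a \<Rightarrow> 'a \<Rightarrow> bool" where
  "mv_le M x y \<longleftrightarrow> oplus M (neg M x) y = neg M (zero M)"

definition mv_ideal :: "'a mv_struct \<Rightarrow> 'a set \<Rightarrow> bool" where
  "mv_ideal M I \<longleftrightarrow> I \<subseteq> carr M \<and> zero M \<in> I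
     \<and> (\<forall>x\<in>I. \<forall>y\<in>carr M. mv_le M y x \<longrightarrow> y \<in> I)
     \<and> (\<forall>x\<in>I. \<forall>y\<in>I. oplus M x y \<in> I)"

definition mv_simple :: "'a mv_struct \<Rightarrow> bool" where
  "mv_simple M \<longleftrightarrow> mv_algebra M \<and> card {I. mv_ideal M I} = 2"

definition mv_embedding :: "'a mv_struct \<Rightarrow> 'b mv_struct \<Rightarrow> ('a \<Rightarrow> 'b) \<Rightarrow> bool" where
  "mv_embedding M N f \<longleftrightarrow> f ` carr M \<subseteq> carr N \<and> inj_on f (carr M)
     \<and> f (zero M) = zero N
     \<and> (\<forall>x\<in>carr M. f (neg M x) = neg N (f x))
     \<and> (\<forall>x\<in>carr M. \<forall>y\<in>carr M. f (oplus M x y) = oplus N (f x) (f y))"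

definition embeds_in :: "'a mv_struct \<Rightarrow> 'b mv_struct \<Rightarrow> bool" where
  "embeds_in M N \<longleftrightarrow> (\<exists>f. mv_embedding M N f)"

definition finite_chain :: "nat \<Rightarrow> int mv_struct" where
  "finite_chain n = \<lparr>carr = {0..int n}, oplus = (\<lambda>x y. min (x + y) (int n)),
     neg = (\<lambda>x. int n - x), zero = 0\<rparr>"

definition rat_unit_interval :: "rat mv_struct" where
  "rat_unit_interval = \<lparr>carr = {0..1}, oplus = (\<lambda>x y. min (x + y) 1),
     neg = (\<lambda>x. 1 - x), zero = 0\<rparr>"


section \<open>Geometric logic over the signature of MV-algebras\<close>

datatype mv_term = Var nat | Zero | Oplus mv_term mv_term | Neg mv_term

text \<open>
  Disjunctions are indexed by arbitrary (possibly empty, possibly infinite) subsets of the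
  type \<open>'i\<close>. A disjunction indexed by a set of any size is available for a suitable
  choice of \<open>'i\<close>, so results about all geometric formulae are to be stated with \<open>'i\<close> as a
  type variable. The type \<open>'i\<close> has to be infinite, as a finite one gives only finitary
  (coherent) formulae. The signature has no relation symbols, so equations are the only atomic
  formulae.
\<close>
datatype 'i geom_fm =
    Eq mv_term mv_term
  | Top
  | And "'i geom_fm" "'i geom_fm"
  | Ex nat "'i geom_fm"
  | Disj "'i set" "'i \<Rightarrow> 'i geom_fm"

fun tvars :: "mv_term \<Rightarrow> nat set" where
  "tvars (Var i) = {i}"
| "tvars Zero = {}"
| "tvars (Oplus s t) = tvars s \<union> tvars t"
| "tvars (Neg t) = tvars t"

primrec fvars :: "'i geom_fm \<Rightarrow> nat set" where
  "fvars (Eq s t) = tvars s \<union> tvars t"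
| "fvars Top = {}"
| "fvars (And p q) = fvars p \<union> fvars q"
| "fvars (Ex i p) = fvars p - {i}"
| "fvars (Disj J p) = (\<Union>j\<in>J. fvars (p j))"

fun tval :: "'a mv_struct \<Rightarrow> (nat \<Rightarrow> 'a) \<Rightarrow> mv_term \<Rightarrow> 'a" where
  "tval M v (Var i) = v i"
| "tval M v Zero = zero M"
| "tval M v (Oplus s t) = oplus M (tval M v s) (tval M v t)"
| "tval M v (Neg t) = neg M (tval M v t)"

primrec holds :: "'a mv_struct \<Rightarrow> 'i geom_fm \<Rightarrow> (nat \<Rightarrow> 'a) \<Rightarrow> bool" where
  "holds M (Eq s t) v \<longleftrightarrow> tval M v s = tval M v t"
| "holds M Top v \<longleftrightarrow> True"
| "holds M (And p q) v \<longleftrightarrow> holds M p v \<and> holds M q v"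
| "holds M (Ex i p) v \<longleftrightarrow> (\<exists>a\<in>carr M. holds M p (v(i := a)))"
| "holds M (Disj J p) v \<longleftrightarrow> (\<exists>j\<in>J. holds M (p j) v)"

text \<open>\<open>Sequent xs \<phi> \<psi>\<close> stands for \<open>\<phi>\<close> entails \<open>\<psi>\<close> in the context \<open>xs\<close>.\<close>
datatype 'i geom_sequent = Sequent "nat list" "'i geom_fm" "'i geom_fm"

text \<open>
  The finite context bounds the free variables of a formula even where it contains an
  infinitary disjunction.
\<close>
fun geometric_sequent :: "'i geom_sequent \<Rightarrow> bool" where
  "geometric_sequent (Sequent xs p q) \<longleftrightarrow> distinct xs \<and> fvars p \<subseteq> set xs \<and> fvars q \<subseteq> set xs"

fun satisfies :: "'a mv_struct \<Rightarrow> 'i geom_sequent \<Rightarrow> bool" where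
  "satisfies M (Sequent xs p q) \<longleftrightarrow>
     (\<forall>v. (\<forall>i\<in>set xs. v i \<in> carr M) \<longrightarrow> holds M p v \<longrightarrow> holds M q v)"

definition is_model :: "'a mv_struct \<Rightarrow> 'i geom_sequent set \<Rightarrow> bool" where
  "is_model M T \<longleftrightarrow> mv_structure M \<and> (\<forall>\<sigma>\<in>T. satisfies M \<sigma>)"

definition theory_of_finite_chains :: "'i geom_sequent set" where
  "theory_of_finite_chains = {\<sigma>. geometric_sequent \<sigma> \<and> (\<forall>n\<ge>1. satisfies (finite_chain n) \<sigma>)}"

end

theory Submission
  imports Defs "HOL-Library.Countable"
begin

text \<open>
  Both directions rest on how geometric formulae see a finite chain \<open>S\<^sub>N\<close>, whose element \<open>a\<close>
  is thought of as the rational number \<open>a / N\<close>.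

  From a model to an embedding. For every rational \<open>q\<close> there is a geometric formula
  expressing that \<open>x\<close> has the value \<open>q\<close>: for some fraction \<open>k / n = q\<close> there is an element
  \<open>z\<close>, playing the role of \<open>1 / n\<close>, with \<open>(n - 1) z = \<not> z\<close> and \<open>x = k z\<close>. In \<open>S\<^sub>N\<close> it says
  precisely that \<open>x / N = q\<close> (\<open>has_value_finite_chain\<close>). Hence the sequents stating that every
  element has exactly one value, that equal values belong to equal elements, and that values
  respect the operations are all valid in finite chains. A model satisfies these sequents, so in
  a model the formula defines the graph of an embedding into \<open>\<rat> \<inter> [0,1]\<close>. In particular the
  axioms of MV-algebras need no separate treatment: they are inherited along the embedding.

  From an embedding to a model. The truth of a geometric formula is witnessed by finitely
  many elements, because existential quantifiers are the only place where the carrier matters and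
  a disjunction needs just one true member (\<open>finite_witnesses\<close>). Finitely many elements of a
  subalgebra of \<open>\<rat> \<inter> [0,1]\<close> have a common denominator \<open>D\<close>; the elements with denominator
  \<open>D\<close> form a subalgebra of \<open>S\<^sub>D\<close>, and by Euclid's argument such a subalgebra consists of
  all multiples of a divisor of \<open>D\<close>, so it is itself a finite chain
  (\<open>finite_subset_in_finite_chain\<close>). A sequent can thus be tested inside a finite chain, and
  its conclusion goes up again since geometric formulae are preserved by enlarging the carrier.

  Simplicity is the Archimedean property: a multiple of any nonzero element of a subalgebra
  of \<open>[0,1]\<close> reaches \<open>1\<close>.
\<close>

section \<open>Structures and embeddings\<close>

lemma finite_chain_simps [simp]:
  "carr (finite_chain n) = {0..int n}"
  "oplus (finite_chain n) = (\<lambda>x y. min (x + y) (int n))"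
  "neg (finite_chain n) = (\<lambda>x. int n - x)"
  "zero (finite_chain n) = 0"
  by (simp_all add: finite_chain_def)

lemma rat_unit_interval_simps [simp]:
  "carr rat_unit_interval = {0..1}"
  "oplus rat_unit_interval = (\<lambda>x y. min (x + y) 1)"
  "neg rat_unit_interval = (\<lambda>x. 1 - x)"
  "zero rat_unit_interval = 0"
  by (simp_all add: rat_unit_interval_def)

lemma mv_structure_finite_chain: "mv_structure (finite_chain n)"
  by unfold_locales auto

lemma mv_algebra_rat_unit_interval: "mv_algebra rat_unit_interval"
  by unfold_locales (auto simp: min_def)

text \<open>The axioms of MV-algebras are universally quantified equations, so injective
  homomorphisms reflect them.\<close>
lemma mv_algebra_of_embedding:
  assumes M: "mv_structure M" and N: "mv_algebra N" and f: "mv_embedding M N f"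
  shows "mv_algebra M"
proof -
  interpret M: mv_structure M by (rule M)
  interpret N: mv_algebra N by (rule N)
  have carr: "f x \<in> carr N" if "x \<in> carr M" for x
    using f that by (auto simp: mv_embedding_def)
  have hom: "f (zero M) = zero N"
    "x \<in> carr M \<Longrightarrow> f (neg M x) = neg N (f x)"
    "x \<in> carr M \<Longrightarrow> y \<in> carr M \<Longrightarrow> f (oplus M x y) = oplus N (f x) (f y)" for x y
    using f by (auto simp: mv_embedding_def)
  have inj: "x = y" if "f x = f y" "x \<in> carr M" "y \<in> carr M" for x y
    using f that by (auto simp: mv_embedding_def inj_on_def)
  note closed = M.oplus_closed M.neg_closed M.zero_closed
  show ?thesis
  proof
    fix x y assume "x \<in> carr M" "y \<in> carr M"
    then show "oplus M (neg M (oplus M (neg M x) y)) y = oplus M (neg M (oplus M (neg M y) x)) x"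
      by (intro inj) (simp_all add: hom carr closed N.lukasiewicz)
  next
    fix x y assume "x \<in> carr M" "y \<in> carr M"
    then show "oplus M x y = oplus M y x"
      by (intro inj) (simp_all add: hom carr closed N.oplus_comm)
  qed (rule inj; simp add: hom carr closed N.oplus_assoc N.oplus_zero N.neg_neg N.oplus_neg_zero)+
qed

primrec multiple :: "'a mv_struct \<Rightarrow> nat \<Rightarrow> 'a \<Rightarrow> 'a" where
  "multiple M 0 x = zero M"
| "multiple M (Suc k) x = oplus M x (multiple M k x)"

lemma (in mv_structure) multiple_closed: "x \<in> carr M \<Longrightarrow> multiple M k x \<in> carr M"
  by (induction k) (auto simp: zero_closed oplus_closed)

lemma multiple_finite_chain:
  "z \<ge> 0 \<Longrightarrow> multiple (finite_chain N) k z = min (int k * z) (int N)"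
proof (induction k)
  case (Suc k)
  then show ?case
    by (simp add: min_def algebra_simps)
qed simp

lemma multiple_embedded_rat:
  assumes "mv_structure M" and f: "mv_embedding M rat_unit_interval f" and x: "x \<in> carr M"
  shows "f (multiple M k x) = min (of_nat k * f x) 1"
proof -
  interpret mv_structure M by fact
  have fx: "0 \<le> f x" using f x by (auto simp: mv_embedding_def)
  show ?thesis
  proof (induction k)
    case 0
    then show ?case using f by (simp add: mv_embedding_def)
  next
    case (Suc k)
    then show ?case
      using f x fx multiple_closed[OF x, of k]
      by (simp add: mv_embedding_def min_def algebra_simps)
  qed
qed


section \<open>Geometric formulae under changes of valuation and carrier\<close>

lemma tval_cong: "(\<And>i. i \<in> tvars t \<Longrightarrow> v i = w i) \<Longrightarrow> tval M v t = tval M w t"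
  by (induction t) auto

lemma holds_cong: "(\<And>i. i \<in> fvars p \<Longrightarrow> v i = w i) \<Longrightarrow> holds M p v \<longleftrightarrow> holds M p w"
proof (induction p arbitrary: v w)
  case (Eq s t)
  then show ?case using tval_cong[of s v w M] tval_cong[of t v w M] by simp
next
  case (And p q)
  have "holds M p v \<longleftrightarrow> holds M p w" "holds M q v \<longleftrightarrow> holds M q w"
    by (rule And.IH; simp add: And.prems)+
  then show ?case by simp
next
  case (Ex i p)
  have "holds M p (v(i := a)) \<longleftrightarrow> holds M p (w(i := a))" for a
    by (rule Ex.IH) (simp add: Ex.prems)
  then show ?case by simp
next
  case (Disj J p)
  have "holds M (p j) v \<longleftrightarrow> holds M (p j) w" if "j \<in> J" for j
    by (rule Disj.IH) (use that Disj.prems in auto)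
  then show ?case by auto
qed simp

lemma tval_carr [simp]: "tval (M\<lparr>carr := S\<rparr>) v t = tval M v t"
  by (induction t) auto

lemma holds_carr_mono:
  "S \<subseteq> carr M \<Longrightarrow> holds (M\<lparr>carr := S\<rparr>) p v \<Longrightarrow> holds M p v"
proof (induction p arbitrary: v)
  case (Disj J p)
  then show ?case by (auto intro: Disj.IH[OF rangeI])
qed auto

text \<open>
  Disjunctions may be infinite, but only the true member that is chosen contributes witnesses, so
  a finite set of witnesses suffices. The set \<open>S\<close> can be any superset of it, closed under the
  operations or not, because the evaluation of terms does not depend on the carrier.
\<close>
lemma finite_witnesses:
  "holds M p v \<Longrightarrow> \<exists>F. finite F \<and> F \<subseteq> carr M \<and> (\<forall>S. F \<subseteq> S \<longrightarrow> holds (M\<lparr>carr := S\<rparr>) p v)"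
proof (induction p arbitrary: v)
  case (And p q)
  from And.prems have "holds M p v" "holds M q v" by simp_all
  then obtain F G where
    "finite F" "F \<subseteq> carr M" "\<And>S. F \<subseteq> S \<Longrightarrow> holds (M\<lparr>carr := S\<rparr>) p v"
    "finite G" "G \<subseteq> carr M" "\<And>S. G \<subseteq> S \<Longrightarrow> holds (M\<lparr>carr := S\<rparr>) q v"
    using And.IH by meson
  then show ?case by (intro exI[of _ "F \<union> G"]) simp
next
  case (Ex i p)
  then obtain a where a: "a \<in> carr M" "holds M p (v(i := a))" by auto
  then obtain F where "finite F" "F \<subseteq> carr M"
    "\<And>S. F \<subseteq> S \<Longrightarrow> holds (M\<lparr>carr := S\<rparr>) p (v(i := a))"
    using Ex.IH by meson
  with a show ?case by (intro exI[of _ "insert a F"]) auto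
next
  case (Disj J p)
  then obtain j where j: "j \<in> J" "holds M (p j) v" by auto
  then obtain F where "finite F" "F \<subseteq> carr M"
    "\<And>S. F \<subseteq> S \<Longrightarrow> holds (M\<lparr>carr := S\<rparr>) (p j) v"
    using Disj.IH[of "p j"] by (meson rangeI)
  with j show ?case by (intro exI[of _ F]) auto
qed (auto intro!: exI[of _ "{}"])

text \<open>An embedding is an isomorphism onto its image.\<close>
lemma holds_embedding_image:
  assumes N: "mv_structure N" and g: "mv_embedding N M g"
  shows "(\<And>i. v i \<in> carr N) \<Longrightarrow>
    holds (M\<lparr>carr := g ` carr N\<rparr>) p (g \<circ> v) \<longleftrightarrow> holds N p v"
proof (induction p arbitrary: v)
  case (Eq s t)
  interpret N: mv_structure N by (rule N)
  have tval: "tval N v t \<in> carr N \<and> tval M (g \<circ> v) t = g (tval N v t)" for t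
    using g Eq by (induction t) (auto simp: mv_embedding_def N.oplus_closed N.neg_closed N.zero_closed)
  have "inj_on g (carr N)" using g by (simp add: mv_embedding_def)
  then show ?case by (simp only: holds.simps tval_carr) (simp only: tval inj_on_eq_iff)
next
  case (Ex i p)
  have "holds (M\<lparr>carr := g ` carr N\<rparr>) p ((g \<circ> v)(i := g a)) \<longleftrightarrow> holds N p (v(i := a))"
    if "a \<in> carr N" for a
  proof -
    have "(g \<circ> v)(i := g a) = g \<circ> v(i := a)" by auto
    moreover have "(v(i := a)) j \<in> carr N" for j using Ex.prems that by simp
    ultimately show ?thesis by (simp only: Ex.IH)
  qed
  then show ?case by (simp add: comp_def)
qed auto


section \<open>Subalgebras of the rational unit interval are models\<close>

text \<open>
  This is Euclid's argument: truncated addition and complement yield the subtraction of a smaller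
  element from a larger one, so the least positive element divides all others.
\<close>
lemma finite_chain_subalgebra:
  fixes G :: "nat set"
  assumes D: "D > 0" "D \<in> G" and le: "\<And>m. m \<in> G \<Longrightarrow> m \<le> D"
    and add: "\<And>m k. m \<in> G \<Longrightarrow> k \<in> G \<Longrightarrow> min (m + k) D \<in> G"
    and compl: "\<And>m. m \<in> G \<Longrightarrow> D - m \<in> G"
  obtains d n where "D = d * n" "G = (\<lambda>j. d * j) ` {..n}"
proof -
  define d where "d = (LEAST m. 0 < m \<and> m \<in> G)"
  have d: "0 < d" "d \<in> G"
    using LeastI[of "\<lambda>m. 0 < m \<and> m \<in> G" D] D by (auto simp: d_def)
  have least: "d \<le> m" if "0 < m" "m \<in> G" for m
    using that Least_le[of "\<lambda>m. 0 < m \<and> m \<in> G" m] by (auto simp: d_def)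
  have diff: "m - k \<in> G" if "m \<in> G" "k \<in> G" "k \<le> m" for m k
  proof -
    have "D - min ((D - m) + k) D = m - k"
      using le[OF that(1)] that(3) by auto
    then show ?thesis
      using compl[OF add[OF compl[OF that(1)] that(2)]] by simp
  qed
  have dvd: "d dvd m" if "m \<in> G" for m
    using that
  proof (induction m rule: less_induct)
    case (less m)
    show ?case
    proof (cases "m = 0")
      case False
      with less.prems have "d \<le> m" by (simp add: least)
      with less d have "d dvd m - d" by (intro less.IH diff) auto
      with \<open>d \<le> m\<close> show ?thesis by (simp add: dvd_diff_nat dvd_minus_self)
    qed simp
  qed
  then obtain n where n: "D = d * n" using D(2) by blast
  have "d * j \<in> G" if "j \<le> n" for j
    using that
  proof (induction j)
    case 0
    show ?case using compl[OF D(2)] by simp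
  next
    case (Suc j)
    then have "d * j \<in> G" by simp
    moreover have "d * j + d \<le> D"
      using mult_le_mono2[OF Suc.prems, of d] n by simp
    ultimately show ?case
      using add[of "d * j" d] d(2) by (simp add: add.commute)
  qed
  moreover have "m \<in> (\<lambda>j. d * j) ` {..n}" if "m \<in> G" for m
    using dvd[OF that] le[OF that] n d(1) by (auto simp: dvd_def)
  ultimately have "G = (\<lambda>j. d * j) ` {..n}" by auto
  with n show ?thesis by (rule that)
qed

lemma truncated_sum_of_fractions:
  fixes a b :: int and n :: nat
  assumes "n > 0"
  shows "min (of_int a / of_nat n + of_int b / of_nat n) 1
    = (of_int (min (a + b) (int n)) / of_nat n :: rat)"
proof -
  have "(of_int a / of_nat n + of_int b / of_nat n \<le> (1::rat)) \<longleftrightarrow> of_int (a + b) \<le> (of_nat n :: rat)"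
    using assms by (simp add: divide_le_eq_1 flip: add_divide_distrib)
  also have "\<dots> \<longleftrightarrow> a + b \<le> int n"
    by (metis of_int_le_iff of_int_of_nat_eq)
  finally show ?thesis
    using assms by (simp add: min_def add_divide_distrib)
qed

lemma common_denominator:
  fixes X :: "rat set"
  assumes "finite X" "X \<subseteq> {0..}"
  obtains D :: nat where "D > 0" "\<And>x. x \<in> X \<Longrightarrow> \<exists>m::nat. x = of_nat m / of_nat D"
proof -
  have "\<exists>D::nat>0. \<forall>x\<in>X. \<exists>m::nat. x = of_nat m / of_nat D"
    using assms
  proof (induction X rule: finite_induct)
    case (insert x X)
    then obtain D :: nat where D: "D > 0" "\<forall>x\<in>X. \<exists>m::nat. x = of_nat m / of_nat D" by auto
    obtain a b where ab: "x = Fract a b" "b > 0" by (cases x) auto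
    with insert.prems have "a \<ge> 0" by (simp add: zero_le_Fract_iff)
    then have x: "x = of_nat (nat a) / of_nat (nat b)"
      using ab by (simp add: Fract_of_int_quotient of_nat_nat)
    have "\<exists>m::nat. y = of_nat m / of_nat (nat b * D)" if y: "y \<in> insert x X" for y
    proof (cases "y = x")
      case True
      then show ?thesis
        using x D(1) by (intro exI[of _ "nat a * D"]) simp
    next
      case False
      with y D obtain m :: nat where "y = of_nat m / of_nat D" by auto
      then show ?thesis
        using ab(2) by (intro exI[of _ "nat b * m"]) simp
    qed
    then show ?case using D(1) ab(2) by (intro exI[of _ "nat b * D"]) auto
  qed (auto intro: exI[of _ 1])
  then show ?thesis using that by blast
qed

text \<open>Subalgebras of the rational unit interval are locally finite chains.\<close>
lemma finite_subset_in_finite_chain: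
  assumes "mv_structure M" and f: "mv_embedding M rat_unit_interval f"
    and F: "finite F" "F \<subseteq> carr M"
  obtains n g where "n \<ge> 1" "mv_embedding (finite_chain n) M g" "F \<subseteq> g ` {0..int n}"
proof -
  interpret mv_structure M by fact
  have inj: "inj_on f (carr M)" and f01: "\<And>x. x \<in> carr M \<Longrightarrow> 0 \<le> f x \<and> f x \<le> 1"
    and f_zero: "f (zero M) = 0"
    and f_neg: "\<And>x. x \<in> carr M \<Longrightarrow> f (neg M x) = 1 - f x"
    and f_oplus: "\<And>x y. x \<in> carr M \<Longrightarrow> y \<in> carr M \<Longrightarrow> f (oplus M x y) = min (f x + f y) 1"
    using f by (auto simp: mv_embedding_def)
  obtain D :: nat where D: "D > 0" "\<And>x. x \<in> f ` F \<Longrightarrow> \<exists>m::nat. x = of_nat m / of_nat D"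
    using common_denominator[of "f ` F"] F f01 by (metis atLeast_iff finite_imageI image_subset_iff subset_iff)
  define G where "G = {m::nat. of_nat m / of_nat D \<in> f ` carr M}"
  have "D \<in> G"
  proof -
    have "f (neg M (zero M)) = 1" by (simp add: f_neg f_zero zero_closed)
    then have "1 \<in> f ` carr M" using neg_closed[OF zero_closed] by (metis image_eqI)
    then show ?thesis using D(1) by (simp add: G_def)
  qed
  moreover have le: "m \<le> D" if "m \<in> G" for m
  proof -
    from that obtain x where "x \<in> carr M" "f x = of_nat m / of_nat D" by (auto simp: G_def)
    with f01 have "(of_nat m :: rat) / of_nat D \<le> 1" by metis
    then show ?thesis using D(1) by (simp add: divide_le_eq_1)
  qed
  moreover have "min (m + k) D \<in> G" if "m \<in> G" "k \<in> G" for m k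
  proof -
    from that obtain x y where xy: "x \<in> carr M" "y \<in> carr M"
      "f x = of_nat m / of_nat D" "f y = of_nat k / of_nat D" by (auto simp: G_def)
    have "f (oplus M x y) = of_nat (min (m + k) D) / of_nat D"
      using xy truncated_sum_of_fractions[OF D(1), of "int m" "int k"]
      by (simp add: f_oplus flip: of_nat_add of_nat_min)
    then show ?thesis using oplus_closed[OF xy(1,2)] by (auto simp: G_def image_iff intro: sym)
  qed
  moreover have "D - m \<in> G" if m: "m \<in> G" for m
  proof -
    from m obtain x where x: "x \<in> carr M" "f x = of_nat m / of_nat D" by (auto simp: G_def)
    have "f (neg M x) = of_nat (D - m) / of_nat D"
      using x D(1) le[OF m] by (simp add: f_neg of_nat_diff diff_divide_distrib)
    then show ?thesis using neg_closed[OF x(1)] by (auto simp: G_def image_iff intro: sym)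
  qed
  ultimately obtain d n where dn: "D = d * n" "G = (\<lambda>j. d * j) ` {..n}"
    using finite_chain_subalgebra[OF D(1)] by metis
  with D(1) have pos: "d > 0" "n > 0" by auto
  have cancel: "(of_nat (d * j) / of_nat D :: rat) = of_nat j / of_nat n" for j
    using pos dn(1) by simp
  define g where "g j = inv_into (carr M) f (of_int j / of_nat n)" for j
  have fraction: "of_int j / of_nat n \<in> f ` carr M" if "j \<in> {0..int n}" for j
  proof -
    obtain i where i: "j = int i" "i \<le> n" using \<open>j \<in> _\<close> by (auto elim: nonneg_int_cases)
    then have "d * i \<in> G" using dn(2) by auto
    then show ?thesis using i cancel[of i] by (simp add: G_def)
  qed
  then have g: "g j \<in> carr M" "f (g j) = of_int j / of_nat n" if "j \<in> {0..int n}" for j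
    using that by (auto simp only: g_def inv_into_into f_inv_into_f)
  have eqI: "x = y" if "f x = f y" "x \<in> carr M" "y \<in> carr M" for x y
    using inj that by (auto dest: inj_onD)
  have "mv_embedding (finite_chain n) M g"
    unfolding mv_embedding_def finite_chain_simps
  proof (intro conjI ballI)
    show "g ` {0..int n} \<subseteq> carr M" using g(1) by auto
    show "inj_on g {0..int n}"
    proof (rule inj_onI)
      fix i j assume "i \<in> {0..int n}" "j \<in> {0..int n}" "g i = g j"
      then have "(of_int i :: rat) / of_nat n = of_int j / of_nat n" by (metis g(2))
      then show "i = j" using pos by simp
    qed
    show "g 0 = zero M"
      using g[of 0] by (intro eqI) (simp_all add: f_zero zero_closed)
  next
    fix i assume i: "i \<in> {0..int n}"
    then have "int n - i \<in> {0..int n}" by auto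
    note gi = g[OF i] and gn = g[OF this]
    show "g (int n - i) = neg M (g i)"
      using gi gn pos by (intro eqI) (simp_all add: f_neg neg_closed diff_divide_distrib)
  next
    fix i j assume ij: "i \<in> {0..int n}" "j \<in> {0..int n}"
    then have "min (i + j) (int n) \<in> {0..int n}" by auto
    note gi = g[OF ij(1)] and gj = g[OF ij(2)] and gs = g[OF this]
    show "g (min (i + j) (int n)) = oplus M (g i) (g j)"
      using gi gj gs truncated_sum_of_fractions[OF pos(2), of i j]
      by (intro eqI) (simp_all add: f_oplus oplus_closed)
  qed
  moreover have "F \<subseteq> g ` {0..int n}"
  proof
    fix x assume x: "x \<in> F"
    then obtain m :: nat where m: "f x = of_nat m / of_nat D" using D(2) by blast
    with x F have "m \<in> G" by (auto simp: G_def image_iff) (metis subsetD)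
    then obtain j where j: "m = d * j" "j \<le> n" using dn(2) by auto
    then have "x = g (int j)"
      using m g[of "int j"] x F by (intro eqI) (auto simp: cancel simp del: of_nat_mult)
    then show "x \<in> g ` {0..int n}" using j by auto
  qed
  ultimately show ?thesis using that[of n g] pos by simp
qed

lemma is_model_of_embedding:
  assumes M: "mv_structure M" and f: "mv_embedding M rat_unit_interval f"
  shows "is_model M theory_of_finite_chains"
  unfolding is_model_def
proof (intro conjI ballI)
  fix \<sigma> :: "'i geom_sequent" assume "\<sigma> \<in> theory_of_finite_chains"
  moreover obtain xs p q where \<sigma>: "\<sigma> = Sequent xs p q" by (cases \<sigma>)
  ultimately have fv: "fvars p \<subseteq> set xs" "fvars q \<subseteq> set xs"
    and chains: "\<And>n. n \<ge> 1 \<Longrightarrow> satisfies (finite_chain n) (Sequent xs p q)"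
    by (auto simp: theory_of_finite_chains_def)
  have "holds M q v" if v: "\<forall>i\<in>set xs. v i \<in> carr M" and p: "holds M p v" for v
  proof -
    obtain F where F: "finite F" "F \<subseteq> carr M" "\<And>S. F \<subseteq> S \<Longrightarrow> holds (M\<lparr>carr := S\<rparr>) p v"
      using finite_witnesses[OF p] by blast
    obtain n g where n: "n \<ge> 1" and g: "mv_embedding (finite_chain n) M g"
      and sub: "F \<union> v ` set xs \<subseteq> g ` {0..int n}"
      using finite_subset_in_finite_chain[OF M f, of "F \<union> v ` set xs"] F(1,2) v
      by (metis List.finite_set finite_Un finite_imageI image_subset_iff Un_least)
    let ?S = "g ` carr (finite_chain n)"
    \<comment> \<open>Variables outside the context may take values outside the chain; they are sent to \<open>0\<close>.\<close>
    define w where "w i = (if i \<in> set xs then inv_into {0..int n} g (v i) else 0)" for i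
    have w: "w i \<in> carr (finite_chain n)" for i
      using sub inv_into_into[of "v i" g "{0..int n}"] by (auto simp: w_def)
    have vw: "v i = (g \<circ> w) i" if "i \<in> set xs" for i
      using that sub by (auto simp: w_def intro!: f_inv_into_f[symmetric])
    note transfer = holds_embedding_image[OF mv_structure_finite_chain g, of w, OF w]
    have "holds (M\<lparr>carr := ?S\<rparr>) p v" using F(3) sub by simp
    then have "holds (M\<lparr>carr := ?S\<rparr>) p (g \<circ> w)"
      using holds_cong[of p v "g \<circ> w"] vw fv(1) by blast
    then have "holds (finite_chain n) p w" using transfer by blast
    then have "holds (finite_chain n) q w" using chains[OF n] w by simp
    then have "holds (M\<lparr>carr := ?S\<rparr>) q (g \<circ> w)" using transfer by blast
    moreover have "?S \<subseteq> carr M" using g by (simp add: mv_embedding_def)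
    ultimately have "holds M q (g \<circ> w)" by (rule holds_carr_mono[rotated])
    then show ?thesis using holds_cong[of q v "g \<circ> w"] vw fv(2) by blast
  qed
  then show "satisfies M \<sigma>" by (simp add: \<sigma>)
qed (rule M)


section \<open>Rational values are definable by geometric formulae\<close>

text \<open>
  The element \<open>z\<close> stands for \<open>1 / n\<close>: the equation \<open>(n - 1) z = \<not> z\<close> is a way of saying
  \<open>n z = 1\<close> that survives truncation.
\<close>
definition has_value :: "'a mv_struct \<Rightarrow> rat \<Rightarrow> 'a \<Rightarrow> bool" where
  "has_value M q a \<longleftrightarrow> (\<exists>(n, k) \<in> {(n, k). 0 < n \<and> k \<le> n \<and> of_nat k / of_nat n = q}.
     \<exists>z\<in>carr M. multiple M (n - 1) z = neg M z \<and> a = multiple M k z)"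

lemma has_value_finite_chain:
  assumes N: "N \<ge> 1" and a: "0 \<le> a" "a \<le> int N"
  shows "has_value (finite_chain N) q a \<longleftrightarrow> q = of_int a / of_nat N"
proof
  assume "has_value (finite_chain N) q a"
  then obtain n k z where nk: "0 < n" "k \<le> n" "of_nat k / of_nat n = q"
    and z: "0 \<le> z" "z \<le> int N"
    and eq: "min (int (n - 1) * z) (int N) = int N - z" and az: "a = min (int k * z) (int N)"
    by (auto simp: has_value_def multiple_finite_chain)
  \<comment> \<open>If \<open>z\<close> were \<open>0\<close>, the equation would read \<open>0 = N\<close>; and for \<open>z > 0\<close> the right-hand side
    lies below \<open>N\<close>, so the sum on the left is not truncated.\<close>
  have "z > 0" using eq z N by (cases "z = 0") auto
  with eq have "int (n - 1) * z = int N - z" by (auto simp: min_def split: if_splits)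
  with nk(1) have N_eq: "int N = int n * z" by (simp add: of_nat_diff algebra_simps)
  moreover have "int k * z \<le> int n * z" using nk(2) z by (intro mult_right_mono) auto
  ultimately have "a = int k * z" using az by simp
  moreover have "(of_nat N :: rat) = of_nat n * of_int z"
    using N_eq by (metis of_int_mult of_int_of_nat_eq)
  ultimately show "q = of_int a / of_nat N" using nk(3) \<open>z > 0\<close> by auto
next
  assume "q = of_int a / of_nat N"
  \<comment> \<open>The generator \<open>1\<close> of the chain serves as \<open>1 / N\<close>.\<close>
  then show "has_value (finite_chain N) q a"
    using N a unfolding has_value_def
    by (intro bexI[of _ "(N, nat a)"]) (auto simp: multiple_finite_chain of_nat_diff intro!: bexI[of _ 1])
qed

primrec multiple_term :: "nat \<Rightarrow> mv_term \<Rightarrow> mv_term" where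
  "multiple_term 0 t = Zero"
| "multiple_term (Suc k) t = Oplus t (multiple_term k t)"

lemma tval_multiple_term [simp]: "tval M v (multiple_term k t) = multiple M k (tval M v t)"
  by (induction k) auto

lemma tvars_multiple_term: "tvars (multiple_term k t) \<subseteq> tvars t"
  by (induction k) auto

text \<open>
  Disjunctions over countable types are transported to the index type \<open>'i\<close> along an injection
  \<open>e\<close> of the natural numbers, which is where the infinity of \<open>'i\<close> is used.
\<close>
definition countable_disj :: "(nat \<Rightarrow> 'i) \<Rightarrow> 'b::countable set \<Rightarrow> ('b \<Rightarrow> 'i geom_fm) \<Rightarrow> 'i geom_fm" where
  "countable_disj e A p = Disj ((e \<circ> to_nat) ` A) (\<lambda>j. p (inv (e \<circ> to_nat) j))"

lemma countable_disj:
  fixes A :: "'b::countable set"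
  assumes "inj e"
  shows "holds M (countable_disj e A p) v \<longleftrightarrow> (\<exists>a\<in>A. holds M (p a) v)"
    and "fvars (countable_disj e A p) = (\<Union>a\<in>A. fvars (p a))"
proof -
  have "inv (e \<circ> to_nat) (e (to_nat a)) = a" for a :: 'b
    using inv_f_f[of "e \<circ> to_nat" a] assms by (simp add: inj_compose)
  then show "holds M (countable_disj e A p) v \<longleftrightarrow> (\<exists>a\<in>A. holds M (p a) v)"
    and "fvars (countable_disj e A p) = (\<Union>a\<in>A. fvars (p a))"
    by (simp_all add: countable_disj_def)
qed

text \<open>The variable \<open>2\<close> is bound, so \<open>t\<close> has to avoid it; the variables \<open>0\<close> and \<open>1\<close> remain available.\<close>
definition value_fm :: "(nat \<Rightarrow> 'i) \<Rightarrow> rat \<Rightarrow> mv_term \<Rightarrow> 'i geom_fm" where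
  "value_fm e q t = countable_disj e {(n, k). 0 < n \<and> k \<le> n \<and> of_nat k / of_nat n = q}
     (\<lambda>(n, k). Ex 2 (And (Eq (multiple_term (n - 1) (Var 2)) (Neg (Var 2)))
                         (Eq t (multiple_term k (Var 2)))))"

lemma holds_value_fm:
  assumes "inj e" and t: "2 \<notin> tvars t"
  shows "holds M (value_fm e q t) v \<longleftrightarrow> has_value M q (tval M v t)"
proof -
  have "tval M (v(2 := z)) t = tval M v t" for z
    by (rule tval_cong) (use t in auto)
  then show ?thesis
    by (simp add: value_fm_def has_value_def countable_disj(1)[OF assms(1)] split_beta)
qed

lemma fvars_value_fm: "inj e \<Longrightarrow> fvars (value_fm e q t) \<subseteq> tvars t"
  using tvars_multiple_term[of _ "Var 2"] by (fastforce simp: value_fm_def countable_disj(2))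


section \<open>Models embed into the rational unit interval\<close>

text \<open>
  These properties make \<open>has_value M\<close> the graph of an embedding. Each of them is a geometric
  sequent that is valid in finite chains by \<open>has_value_finite_chain\<close>.
\<close>
lemma model_has_value:
  fixes M :: "'a mv_struct"
  assumes infinite: "infinite (UNIV :: 'i set)"
    and model: "is_model M (theory_of_finite_chains :: 'i geom_sequent set)"
  shows has_value_total: "x \<in> carr M \<Longrightarrow> \<exists>q\<in>{0..1}. has_value M q x"
    and has_value_unique: "x \<in> carr M \<Longrightarrow> has_value M q x \<Longrightarrow> has_value M r x \<Longrightarrow> q = r"
    and has_value_inj:
      "x \<in> carr M \<Longrightarrow> y \<in> carr M \<Longrightarrow> has_value M q x \<Longrightarrow> has_value M q y \<Longrightarrow> x = y"
    and has_value_zero: "has_value M 0 (zero M)"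
    and has_value_neg: "x \<in> carr M \<Longrightarrow> has_value M q x \<Longrightarrow> has_value M (1 - q) (neg M x)"
    and has_value_oplus: "x \<in> carr M \<Longrightarrow> y \<in> carr M \<Longrightarrow> has_value M q x \<Longrightarrow> has_value M r y
      \<Longrightarrow> has_value M (min (q + r) 1) (oplus M x y)"
proof -
  obtain e :: "nat \<Rightarrow> 'i" where e: "inj e"
    using infinite infinite_countable_subset by blast
  \<comment> \<open>In the context \<open>0, 1\<close>, a valuation is a pair: \<open>x\<close> for the variable \<open>0\<close> and \<open>y\<close> for \<open>1\<close>.\<close>
  have sequent: "holds M \<psi> ((\<lambda>_. y)(0 := x))"
    if "x \<in> carr M" "y \<in> carr M" "holds M \<phi> ((\<lambda>_. y)(0 := x))"
      and "fvars \<phi> \<subseteq> {0, 1}" "fvars \<psi> \<subseteq> {0, 1}"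
      and "\<And>n v. n \<ge> 1 \<Longrightarrow> 0 \<le> v 0 \<Longrightarrow> v 0 \<le> int n \<Longrightarrow> 0 \<le> v 1 \<Longrightarrow> v 1 \<le> int n
        \<Longrightarrow> holds (finite_chain n) \<phi> v \<Longrightarrow> holds (finite_chain n) \<psi> v"
    for x y and \<phi> \<psi> :: "'i geom_fm"
  proof -
    have "Sequent [0, 1] \<phi> \<psi> \<in> theory_of_finite_chains"
      using that(4-) by (simp add: theory_of_finite_chains_def)
    with model have "satisfies M (Sequent [0, 1] \<phi> \<psi>)"
      unfolding is_model_def by blast
    then show ?thesis using that(1-3) by simp
  qed
  note value_simps = holds_value_fm[OF e] countable_disj[OF e] has_value_finite_chain
  note fv = fvars_value_fm[OF e, THEN subset_trans]
  have zero: "zero M \<in> carr M"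
    using model by (simp add: is_model_def mv_structure.zero_closed)
  show "\<exists>q\<in>{0..1}. has_value M q x" if "x \<in> carr M"
    using sequent[of x x Top "countable_disj e {0..1} (\<lambda>q. value_fm e q (Var 0))"] that
    by (simp add: value_simps UN_least fv)
  show "q = r" if "x \<in> carr M" "has_value M q x" "has_value M r x"
  proof (rule ccontr)
    assume "q \<noteq> r"
    with that show False
      using sequent[of x x "And (value_fm e q (Var 0)) (value_fm e r (Var 0))" "Disj {} (\<lambda>_. Top)"]
      by (auto simp: value_simps fv)
  qed
  show "x = y" if "x \<in> carr M" "y \<in> carr M" "has_value M q x" "has_value M q y"
  proof -
    have "holds M (Eq (Var 0) (Var 1) :: 'i geom_fm) ((\<lambda>_. y)(0 := x))"
      by (rule sequent[of x y "And (value_fm e q (Var 0)) (value_fm e q (Var 1))"])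
        (use that in \<open>auto simp: value_simps dest!: fvars_value_fm[OF e, THEN subsetD]\<close>)
    then show ?thesis by simp
  qed
  show "has_value M 0 (zero M)"
    using sequent[of "zero M" "zero M" Top "value_fm e 0 Zero"] zero
    by (simp add: value_simps fv)
  show "has_value M (1 - q) (neg M x)" if "x \<in> carr M" "has_value M q x"
    using sequent[of x x "value_fm e q (Var 0)" "value_fm e (1 - q) (Neg (Var 0))"] that
    by (simp add: value_simps fv diff_divide_distrib)
  show "has_value M (min (q + r) 1) (oplus M x y)"
    if "x \<in> carr M" "y \<in> carr M" "has_value M q x" "has_value M r y"
    using sequent[of x y "And (value_fm e q (Var 0)) (value_fm e r (Var 1))"
        "value_fm e (min (q + r) 1) (Oplus (Var 0) (Var 1))"] that
    by (simp add: value_simps fv truncated_sum_of_fractions)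
qed

lemma model_embeds:
  fixes M :: "'a mv_struct"
  assumes "infinite (UNIV :: 'i set)"
    and "is_model M (theory_of_finite_chains :: 'i geom_sequent set)"
  shows "embeds_in M rat_unit_interval"
proof -
  interpret mv_structure M using assms(2) by (simp add: is_model_def)
  note total = has_value_total[OF assms] and unique = has_value_unique[OF assms]
    and inj = has_value_inj[OF assms] and zero = has_value_zero[OF assms]
    and neg = has_value_neg[OF assms] and oplus = has_value_oplus[OF assms]
  obtain f where f: "\<And>x. x \<in> carr M \<Longrightarrow> f x \<in> {0..1} \<and> has_value M (f x) x"
    using total by metis
  have f_eq: "f x = q" if "x \<in> carr M" "has_value M q x" for x q
    using unique f that by blast
  have "mv_embedding M rat_unit_interval f"
    unfolding mv_embedding_def rat_unit_interval_simps
  proof (intro conjI ballI)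
    show "inj_on f (carr M)" using inj f by (metis inj_onI)
  qed (use f in \<open>auto intro!: f_eq zero neg oplus simp: zero_closed neg_closed oplus_closed\<close>)
  then show ?thesis by (auto simp: embeds_in_def)
qed


section \<open>Simplicity\<close>

lemma mv_simple_of_embedding:
  assumes M: "mv_algebra M" and f: "mv_embedding M rat_unit_interval f"
  shows "mv_simple M"
proof -
  interpret mv_algebra M by (rule M)
  let ?one = "neg M (zero M)"
  have inj: "inj_on f (carr M)" and f01: "\<And>x. x \<in> carr M \<Longrightarrow> 0 \<le> f x \<and> f x \<le> 1"
    and f_zero: "f (zero M) = 0" and f_one: "f ?one = 1"
    using f zero_closed by (auto simp: mv_embedding_def)
  have one: "?one \<in> carr M" by (simp add: neg_closed zero_closed)
  have zero_neq_one: "zero M \<noteq> ?one" using f_zero f_one by auto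
  have "I = carr M" if I: "mv_ideal M I" and x: "x \<in> I" "x \<noteq> zero M" for I x
  proof -
    have xM: "x \<in> carr M" using I x by (auto simp: mv_ideal_def)
    then have "f x \<noteq> 0" using inj x(2) f_zero zero_closed by (metis inj_onD)
    with f01[OF xM] have "0 < f x" by simp
    then obtain k :: nat where "1 < of_nat k * f x" using ex_less_of_nat_mult by blast
    then have "f (multiple M k x) = f ?one"
      using multiple_embedded_rat[OF mv_structure_axioms f xM] f_one by simp
    then have "multiple M k x = ?one"
      using inj one multiple_closed[OF xM] by (metis inj_onD)
    moreover have "multiple M k x \<in> I"
      using I x by (induction k) (auto simp: mv_ideal_def)
    ultimately have "?one \<in> I" by simp
    then show ?thesis
      using I by (auto simp: mv_ideal_def mv_le_def neg_closed oplus_neg_zero)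
  qed
  moreover have "mv_ideal M (carr M)"
    by (simp add: mv_ideal_def zero_closed oplus_closed)
  moreover have "mv_ideal M {zero M}"
  proof -
    have "y = zero M" if "y \<in> carr M" "mv_le M y (zero M)" for y
    proof -
      have "neg M y = neg M (zero M)" using that by (simp add: mv_le_def oplus_zero neg_closed)
      then show ?thesis by (metis neg_neg that(1) zero_closed)
    qed
    then show ?thesis by (auto simp: mv_ideal_def zero_closed oplus_zero)
  qed
  moreover have "I = {zero M} \<or> (\<exists>x\<in>I. x \<noteq> zero M)" if "mv_ideal M I" for I
    using that unfolding mv_ideal_def by blast
  ultimately have "mv_ideal M I \<longleftrightarrow> I = {zero M} \<or> I = carr M" for I by metis
  then have "{I. mv_ideal M I} = {{zero M}, carr M}" by auto
  moreover have "{zero M} \<noteq> carr M" using one zero_neq_one by (metis singletonD)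
  ultimately show ?thesis using M by (simp add: mv_simple_def)
qed


section \<open>Characterization of the models\<close>

theorem theorem9p5:
  fixes M :: "'a mv_struct"
  assumes "infinite (UNIV :: 'i set)"
  shows "(is_model M (theory_of_finite_chains :: 'i geom_sequent set)
            \<longleftrightarrow> mv_algebra M \<and> embeds_in M rat_unit_interval)
       \<and> (mv_algebra M \<and> embeds_in M rat_unit_interval \<longrightarrow> mv_simple M)"
proof (intro conjI iffI impI)
  assume model: "is_model M (theory_of_finite_chains :: 'i geom_sequent set)"
  show embeds: "embeds_in M rat_unit_interval" by (rule model_embeds[OF assms model])
  show "mv_algebra M"
    using embeds model mv_algebra_of_embedding[OF _ mv_algebra_rat_unit_interval]
    by (auto simp: embeds_in_def is_model_def)
next
  assume "mv_algebra M \<and> embeds_in M rat_unit_interval"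
  then show "is_model M (theory_of_finite_chains :: 'i geom_sequent set)"
    by (auto simp: embeds_in_def mv_algebra_def intro: is_model_of_embedding)
next
  assume "mv_algebra M \<and> embeds_in M rat_unit_interval"
  then show "mv_simple M" by (auto simp: embeds_in_def intro: mv_simple_of_embedding)
qed

end
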